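(* Let $X\subset\mathbb{R}^N$ ($N\geqslant 1$) be an open $p$-convex set and let $\phi:\mathbb{R}\times X\to X$ be a flow which is eventually competitive or eventually cooperative with respect to the order induced by a convex cone $C\subset\mathbb{R}^N$. Let $L$ be a limit set of the flow, i.e. the $\omega$-limit set or the $\alpha$-limit set of some point of $X$. Then $L$ cannot contain two points $y,z$ with $y\ll z$.
   Context: A nonempty closed set $C\subset\mathbb{R}^N$ is called a convex cone if $C+C\subset C$, $\alpha C\subset C$ for all $\alpha\geqslant 0$, and $C\cap(-C)=\{0\}$. Write $x\leqslant y$ if $y-x\in C$, and $x\ll y$ if $y-x\in\operatorname{Int}C$. A subset $U\subset\mathbb{R}^N$ is $p$-convex if whenever $x,y\in U$ and $x\leqslant y$, the line segment between $x$ and $y$ is contained in $U$. A flow $\phi_t$ (continuous, defined for all $t\in\mathbb{R}$) on $X$ is eventually cooperative (resp. eventually competitive) if there exists $t_*\geqslant 0$ such that $\phi_t(x)\leqslant\phi_t(y)$ whenever $x,y\in X$, $x\leqslant y$ and $t\geqslant t_*$ (resp. $t\leqslant -t_*$). *)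

theory Defs
  imports "HOL-Analysis.Analysis"
begin

definition order_cone :: "'a::real_normed_vector set \<Rightarrow> bool" where
  "order_cone C \<longleftrightarrow> C \<noteq> {} \<and> closed C \<and> (\<forall>x\<in>C. \<forall>y\<in>C. x + y \<in> C) \<and>
     (\<forall>\<alpha>\<ge>0. \<forall>x\<in>C. \<alpha> *\<^sub>R x \<in> C) \<and> C \<inter> uminus ` C = {0}"

definition cone_le :: "'a::real_normed_vector set \<Rightarrow> 'a \<Rightarrow> 'a \<Rightarrow> bool" where
  "cone_le C x y \<longleftrightarrow> y - x \<in> C"

definition cone_ll :: "'a::real_normed_vector set \<Rightarrow> 'a \<Rightarrow> 'a \<Rightarrow> bool" where
  "cone_ll C x y \<longleftrightarrow> y - x \<in> interior C"

definition p_convex :: "'a::real_normed_vector set \<Rightarrow> 'a set \<Rightarrow> bool" where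
  "p_convex C U \<longleftrightarrow> (\<forall>x\<in>U. \<forall>y\<in>U. cone_le C x y \<longrightarrow> closed_segment x y \<subseteq> U)"

(* The time-t map is phi t; its values outside X are irrelevant. *)
definition flow_on :: "'a::real_normed_vector set \<Rightarrow> (real \<Rightarrow> 'a \<Rightarrow> 'a) \<Rightarrow> bool" where
  "flow_on X \<phi> \<longleftrightarrow>
     (\<forall>t. \<forall>x\<in>X. \<phi> t x \<in> X) \<and>
     (\<forall>x\<in>X. \<phi> 0 x = x) \<and>
     (\<forall>s t. \<forall>x\<in>X. \<phi> (s + t) x = \<phi> s (\<phi> t x)) \<and>
     continuous_on (UNIV \<times> X) (\<lambda>(t, x). \<phi> t x)"

definition eventually_cooperative ::
    "'a::real_normed_vector set \<Rightarrow> 'a set \<Rightarrow> (real \<Rightarrow> 'a \<Rightarrow> 'a) \<Rightarrow> bool" where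
  "eventually_cooperative C X \<phi> \<longleftrightarrow>
     (\<exists>T\<ge>0. \<forall>x\<in>X. \<forall>y\<in>X. \<forall>t\<ge>T. cone_le C x y \<longrightarrow> cone_le C (\<phi> t x) (\<phi> t y))"

definition eventually_competitive ::
    "'a::real_normed_vector set \<Rightarrow> 'a set \<Rightarrow> (real \<Rightarrow> 'a \<Rightarrow> 'a) \<Rightarrow> bool" where
  "eventually_competitive C X \<phi> \<longleftrightarrow>
     (\<exists>T\<ge>0. \<forall>x\<in>X. \<forall>y\<in>X. \<forall>t\<le>-T. cone_le C x y \<longrightarrow> cone_le C (\<phi> t x) (\<phi> t y))"

(* Limit sets are those of a dynamical system on the space X, so accumulation points
   of an orbit on the boundary of X do not belong to them. *)
definition omega_limit :: "'a::real_normed_vector set \<Rightarrow> (real \<Rightarrow> 'a \<Rightarrow> 'a) \<Rightarrow> 'a \<Rightarrow> 'a set" where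
  "omega_limit X \<phi> x =
     {y \<in> X. \<exists>\<tau>::nat \<Rightarrow> real. filterlim \<tau> at_top sequentially \<and> (\<lambda>k. \<phi> (\<tau> k) x) \<longlonglongrightarrow> y}"

definition alpha_limit :: "'a::real_normed_vector set \<Rightarrow> (real \<Rightarrow> 'a \<Rightarrow> 'a) \<Rightarrow> 'a \<Rightarrow> 'a set" where
  "alpha_limit X \<phi> x =
     {y \<in> X. \<exists>\<tau>::nat \<Rightarrow> real. filterlim \<tau> at_bot sequentially \<and> (\<lambda>k. \<phi> (\<tau> k) x) \<longlonglongrightarrow> y}"

end

theory Submission
  imports Defs
begin

text \<open>
  If an orbit \<open>x\<close> of a cooperative flow rises over an interval of length \<open>p\<close> and falls over an
  interval of length \<open>q\<close>, then \<open>x s \<le> x (s + p)\<close> and \<open>x (s + q) \<le> x s\<close> for all large \<open>s\<close>. A strict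
  rise is an open condition, so \<open>p\<close> may be perturbed until \<open>m p = n q\<close> with positive integers
  \<open>m, n\<close>; the resulting cycle of inequalities forces \<open>x s = x (s + p)\<close>, which by the flow
  property contradicts the strict rise. An orbit that accumulates, in either time direction, at
  points \<open>y \<lless> z\<close> has both a strictly rising and a falling interval. Only rising and falling intervals
  enter, so reversing time reduces the competitive case to the cooperative one.
\<close>

lemma cone_le_refl: "order_cone C \<Longrightarrow> cone_le C x x"
  by (auto simp: order_cone_def cone_le_def)

lemma cone_le_trans:
  assumes "order_cone C" "cone_le C x y" "cone_le C y z"
  shows "cone_le C x z"
proof -
  have "(z - y) + (y - x) \<in> C"
    using assms unfolding order_cone_def cone_le_def by blast
  then show ?thesis by (simp add: cone_le_def)
qed

lemma cone_le_antisym: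
  assumes "order_cone C" "cone_le C x y" "cone_le C y x"
  shows "x = y"
proof -
  have "y - x \<in> C \<inter> uminus ` C"
    using assms(2,3) by (auto simp: cone_le_def image_iff intro: bexI[of _ "x - y"])
  moreover have "C \<inter> uminus ` C = {0}"
    using assms(1) by (simp add: order_cone_def)
  ultimately show ?thesis by simp
qed

lemma cone_ll_imp_le: "cone_ll C x y \<Longrightarrow> cone_le C x y"
  using interior_subset by (auto simp: cone_ll_def cone_le_def)

text \<open>If 0 were interior to \<open>C\<close>, the set \<open>interior C\<close> and its
  negative would meet in an open set equal to \<open>{0}\<close>. The class
  \<open>perfect_space\<close> excludes this; for \<open>real ^ 'n\<close> it reflects N \<ge>
  1.\<close>

lemma cone_ll_irrefl:
  fixes C :: "'a::{real_normed_vector, perfect_space} set"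
  assumes "order_cone C"
  shows "\<not> cone_ll C x x"
proof
  assume "cone_ll C x x"
  then have "0 \<in> interior C" by (simp add: cone_ll_def)
  then have "0 \<in> interior C \<inter> uminus ` interior C" by force
  moreover have "interior C \<inter> uminus ` interior C \<subseteq> {0}"
    using assms interior_subset[of C] unfolding order_cone_def by blast
  ultimately have "interior C \<inter> uminus ` interior C = {0}" by blast
  moreover have "open (interior C \<inter> uminus ` interior C)"
    by (intro open_Int open_negations open_interior)
  ultimately show False using not_open_singleton by metis
qed

lemma cone_le_iterate:
  fixes x :: "real \<Rightarrow> 'a::real_normed_vector"
  assumes "order_cone C" "p \<ge> 0" "\<And>u. u \<ge> s \<Longrightarrow> cone_le C (x u) (x (u + p))" "u \<ge> s"
  shows "cone_le C (x u) (x (u + real n * p))"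
proof (induction n)
  case 0
  then show ?case using cone_le_refl[OF assms(1)] by simp
next
  case (Suc n)
  have "u + real n * p \<ge> s" using assms(2,4) by (simp add: add_increasing2)
  from cone_le_trans[OF assms(1) Suc assms(3)[OF this]]
  show ?case by (simp add: algebra_simps)
qed

lemma cone_ge_iterate:
  fixes x :: "real \<Rightarrow> 'a::real_normed_vector"
  assumes "order_cone C" "p \<ge> 0" "\<And>u. u \<ge> s \<Longrightarrow> cone_le C (x (u + p)) (x u)" "u \<ge> s"
  shows "cone_le C (x (u + real n * p)) (x u)"
  \<comment> \<open>Negating the path reverses the order, so a fall becomes a rise.\<close>
  using cone_le_iterate[of C p s "\<lambda>t. - x t" u n] assms by (simp add: cone_le_def)

text \<open>By density of the rationals, some rational \<open>r\<close> slightly above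
  \<open>(b - a) / q\<close> keeps \<open>a + r * q\<close> in the open set \<open>S\<close>. This
  makes the rise length \<open>b' - a\<close> commensurable with the fall length
  \<open>q\<close>.\<close>

lemma rational_multiple_nearby:
  fixes S :: "real set"
  assumes "open S" "b \<in> S" "a < b" "0 < q"
  obtains b' m n where "b' \<in> S" "a < b'" "0 < m" "real m * (b' - a) = real n * q"
proof -
  have "open ((\<lambda>r. a + r * q) -` (S \<inter> {a<..}))"
    using assms(1) by (intro open_vimage continuous_intros) auto
  moreover have "(b - a) / q \<in> (\<lambda>r. a + r * q) -` (S \<inter> {a<..})"
    using assms by simp
  ultimately obtain d where d: "d > 0"
      "\<And>r. dist r ((b - a) / q) < d \<Longrightarrow> a + r * q \<in> S \<inter> {a<..}"
    unfolding open_dist by blast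
  obtain r where r: "r \<in> \<rat>" "(b - a) / q < r" "r < (b - a) / q + d"
    using Rats_dense_in_real[of "(b - a) / q" "(b - a) / q + d"] d(1) by auto
  have "0 < (b - a) / q" using assms by simp
  with r(2) have "0 < r" by linarith
  with r(1) obtain m n where mn: "m \<noteq> 0" "\<bar>r\<bar> = real n / real m"
    using Rats_abs_nat_div_natE by metis
  have "a + r * q \<in> S \<inter> {a<..}"
    using r(2,3) by (intro d(2)) (simp add: dist_real_def)
  moreover have "real m * (a + r * q - a) = real n * q"
    using mn \<open>0 < r\<close> by simp
  ultimately show thesis using mn(1) by (intro that[of "a + r * q" m n]) auto
qed

text \<open>Stated for a bare path in time, so that it applies both to an orbit and to its time
  reversal. Monotonicity holds only for shifts \<open>u \<ge> T\<close>, whereas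
  \<open>shift\<close> allows \<open>u\<close> of either sign.\<close>

lemma no_strict_rise_and_fall:
  fixes x :: "real \<Rightarrow> 'a::{real_normed_vector, perfect_space}"
  assumes C: "order_cone C"
    and cont: "continuous_on UNIV x"
    and mono: "\<And>s t u. u \<ge> T \<Longrightarrow> cone_le C (x s) (x t) \<Longrightarrow> cone_le C (x (s + u)) (x (t + u))"
    and shift: "\<And>s t u. x s = x t \<Longrightarrow> x (s + u) = x (t + u)"
    and rise: "a < b" "cone_ll C (x a) (x b)"
    and fall: "c < d" "cone_le C (x d) (x c)"
  shows False
proof -
  let ?S = "{t. x t - x a \<in> interior C}"
  have "open ?S"
    using open_vimage[OF open_interior continuous_on_diff[OF cont continuous_on_const]]
    by (simp add: vimage_def)
  moreover have "b \<in> ?S" "0 < d - c"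
    using rise(2) fall(1) by (simp_all add: cone_ll_def)
  ultimately obtain b' m n where "b' \<in> ?S"
    and b': "a < b'" "0 < m" "real m * (b' - a) = real n * (d - c)"
    using rational_multiple_nearby rise(1) by metis
  then have ll: "cone_ll C (x a) (x b')" by (simp add: cone_ll_def)
  define p where "p = b' - a"
  define q where "q = d - c"
  \<comment> \<open>From this time on, the shifts from \<open>a\<close> and from \<open>c\<close>
    are both at least \<open>T\<close>.\<close>
  define s where "s = max a c + T"
  have up: "cone_le C (x u) (x (u + p))" if "u \<ge> s" for u
    using mono[OF _ cone_ll_imp_le[OF ll], of "u - a"] that
    by (simp add: s_def p_def algebra_simps)
  have down: "cone_le C (x (u + q)) (x u)" if "u \<ge> s" for u
    using mono[OF _ fall(2), of "u - c"] that by (simp add: s_def q_def algebra_simps)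
  \<comment> \<open>The first period is split off, so that \<open>m - 1\<close> further rises lead
    from \<open>s + p\<close> to \<open>s + m p = s + n q\<close>; the truncated subtraction is
    harmless as \<open>m > 0\<close>.\<close>
  have mp: "real m * p = p + real (m - 1) * p"
    using b'(2) by (cases m) (auto simp: algebra_simps)
  have "cone_le C (x (s + p)) (x (s + p + real (m - 1) * p))"
    using b'(1) by (intro cone_le_iterate[of C p s x, OF C _ up]) (auto simp: p_def)
  also have "s + p + real (m - 1) * p = s + real n * q"
    using b'(3) mp by (simp add: p_def q_def)
  finally have "cone_le C (x (s + p)) (x (s + real n * q))" .
  moreover have "cone_le C (x (s + real n * q)) (x s)"
    using fall(1) by (intro cone_ge_iterate[of C q s x, OF C _ down]) (auto simp: q_def)
  ultimately have "cone_le C (x (s + p)) (x s)"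
    using cone_le_trans[OF C] by blast
  then have "x (s + p) = x s"
    using cone_le_antisym[OF C] up by blast
  \<comment> \<open>The equality is carried from time \<open>s\<close> to time \<open>a\<close>,
    possibly backwards, where it meets the strict rise.\<close>
  from shift[OF this, of "a - s"] have "x b' = x a" by (simp add: p_def algebra_simps)
  with ll cone_ll_irrefl[OF C] show False by simp
qed

text \<open>Far along the two sequences, every \<open>x (\<sigma> j)\<close> lies strictly below
  every \<open>x (\<tau> k)\<close>. The orbit rises or falls according to which of the two times
  comes first, and both orders occur.\<close>

lemma limit_points_rise_and_fall:
  fixes x :: "real \<Rightarrow> 'a::real_normed_vector" and \<sigma> \<tau> :: "nat \<Rightarrow> real"
  assumes F: "F = at_top \<or> F = at_bot"
    and \<sigma>: "filterlim \<sigma> F sequentially" "(\<lambda>k. x (\<sigma> k)) \<longlonglongrightarrow> y"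
    and \<tau>: "filterlim \<tau> F sequentially" "(\<lambda>k. x (\<tau> k)) \<longlonglongrightarrow> z"
    and yz: "cone_ll C y z"
  obtains a b c d where "a < b" "cone_ll C (x a) (x b)" "c < d" "cone_ll C (x d) (x c)"
proof -
  \<comment> \<open>The product filter lets the indices vary independently, which the later choice
    of interleaved times requires.\<close>
  have "((\<lambda>(j, k). x (\<tau> k) - x (\<sigma> j)) \<longlongrightarrow> z - y) (sequentially \<times>\<^sub>F sequentially)"
    unfolding case_prod_beta
    by (rule tendsto_diff[OF filterlim_compose[OF \<tau>(2) filterlim_snd]
          filterlim_compose[OF \<sigma>(2) filterlim_fst]])
  from topological_tendstoD[OF this open_interior, of C] yz
  have "\<forall>\<^sub>F (j, k) in sequentially \<times>\<^sub>F sequentially. cone_ll C (x (\<sigma> j)) (x (\<tau> k))"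
    by (simp add: cone_ll_def case_prod_unfold)
  then obtain N where N: "\<And>j k. j \<ge> N \<Longrightarrow> k \<ge> N \<Longrightarrow> cone_ll C (x (\<sigma> j)) (x (\<tau> k))"
    unfolding eventually_prod_sequentially by auto
  \<comment> \<open>\<open>R r t\<close> says that \<open>t\<close> lies further than
    \<open>r\<close> in the direction of \<open>F\<close>, which treats both time directions at
    once.\<close>
  obtain R :: "real \<Rightarrow> real \<Rightarrow> bool"
    where R: "R = (<) \<or> R = (>)" "\<And>r. \<forall>\<^sub>F t in F. R r t"
  proof (cases "F = at_top")
    case True
    then show thesis using that[of "(<)"] eventually_gt_at_top by simp
  next
    case False
    then show thesis using F that[of "(>)"] eventually_gt_at_bot by simp
  qed
  have beyond: "\<exists>k\<ge>N. R r (\<rho> k)" if "filterlim \<rho> F sequentially" for \<rho> r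
  proof -
    have "\<forall>\<^sub>F k in sequentially. R r (\<rho> k)"
      by (rule eventually_compose_filterlim[OF R(2) that])
    then obtain M where "\<And>k. k \<ge> M \<Longrightarrow> R r (\<rho> k)"
      unfolding eventually_sequentially by blast
    then show ?thesis by (intro exI[of _ "max M N"]) simp
  qed
  obtain k where k: "k \<ge> N" "R (\<sigma> N) (\<tau> k)"
    using beyond[OF \<tau>(1)] by blast
  obtain j where j: "j \<ge> N" "R (\<tau> N) (\<sigma> j)"
    using beyond[OF \<sigma>(1)] by blast
  have ll: "cone_ll C (x (\<sigma> N)) (x (\<tau> k))" "cone_ll C (x (\<sigma> j)) (x (\<tau> N))"
    using N j(1) k(1) by auto
  from R(1) show thesis
  proof
    assume "R = (<)"
    then show thesis using that[OF _ ll(1) _ ll(2)] k(2) j(2) by simp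
  next
    assume "R = (>)"
    then show thesis using that[OF _ ll(2) _ ll(1)] k(2) j(2) by simp
  qed
qed

lemma orbit_continuous:
  assumes "flow_on X \<phi>" "x \<in> X"
  shows "continuous_on UNIV (\<lambda>t. \<phi> t x)"
proof -
  have "continuous_on (UNIV \<times> X) (\<lambda>(t, x). \<phi> t x)"
    using assms(1) by (simp add: flow_on_def)
  moreover have "continuous_on UNIV (\<lambda>t::real. (t, x))"
    by (intro continuous_intros)
  moreover have "range (\<lambda>t::real. (t, x)) \<subseteq> UNIV \<times> X"
    using assms(2) by auto
  ultimately show ?thesis
    using continuous_on_compose2[of "UNIV \<times> X" "\<lambda>(t, x). \<phi> t x" UNIV "\<lambda>t. (t, x)"] by simp
qed

lemma flow_shift:
  assumes "flow_on X \<phi>" "x \<in> X"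
  shows "\<phi> (s + u) x = \<phi> u (\<phi> s x)"
  using assms by (simp add: flow_on_def add.commute[of s u])

theorem theorem3p1:
  fixes X C L :: "(real ^ 'n) set"
    and \<phi> :: "real \<Rightarrow> real ^ 'n \<Rightarrow> real ^ 'n"
  assumes "order_cone C"
    and "open X"
    and "p_convex C X"
    and "flow_on X \<phi>"
    and "eventually_competitive C X \<phi> \<or> eventually_cooperative C X \<phi>"
    and "\<exists>x\<in>X. L = omega_limit X \<phi> x \<or> L = alpha_limit X \<phi> x"
  shows "\<not> (\<exists>y\<in>L. \<exists>z\<in>L. cone_ll C y z)"
proof
  assume "\<exists>y\<in>L. \<exists>z\<in>L. cone_ll C y z"
  then obtain y z where yz: "y \<in> L" "z \<in> L" "cone_ll C y z" by blast
  obtain x where x: "x \<in> X" and "L = omega_limit X \<phi> x \<or> L = alpha_limit X \<phi> x"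
    using assms(6) by blast
  then obtain F where F: "F = at_top \<or> F = at_bot"
    and "L = {y \<in> X. \<exists>\<tau>::nat \<Rightarrow> real. filterlim \<tau> F sequentially \<and> (\<lambda>k. \<phi> (\<tau> k) x) \<longlonglongrightarrow> y}"
    unfolding omega_limit_def alpha_limit_def by blast
  with yz obtain \<sigma> \<tau> :: "nat \<Rightarrow> real" where
    "filterlim \<sigma> F sequentially" "(\<lambda>k. \<phi> (\<sigma> k) x) \<longlonglongrightarrow> y"
    "filterlim \<tau> F sequentially" "(\<lambda>k. \<phi> (\<tau> k) x) \<longlonglongrightarrow> z"
    by blast
  from limit_points_rise_and_fall[OF F this yz(3)] obtain a b c d where
    rise: "a < b" "cone_ll C (\<phi> a x) (\<phi> b x)" and
    fall: "c < d" "cone_ll C (\<phi> d x) (\<phi> c x)" .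
  note shift = flow_shift[OF assms(4) x]
  have orbit: "\<phi> t x \<in> X" for t using assms(4) x by (simp add: flow_on_def)
  note cont = orbit_continuous[OF assms(4) x]
  from assms(5) show False
  proof
    assume "eventually_cooperative C X \<phi>"
    then obtain T where "\<And>x y t. x \<in> X \<Longrightarrow> y \<in> X \<Longrightarrow> t \<ge> T \<Longrightarrow> cone_le C x y
        \<Longrightarrow> cone_le C (\<phi> t x) (\<phi> t y)"
      unfolding eventually_cooperative_def by blast
    then have mono: "\<And>s t u. u \<ge> T \<Longrightarrow> cone_le C (\<phi> s x) (\<phi> t x)
        \<Longrightarrow> cone_le C (\<phi> (s + u) x) (\<phi> (t + u) x)"
      using orbit shift by simp
    have "\<And>s t u. \<phi> s x = \<phi> t x \<Longrightarrow> \<phi> (s + u) x = \<phi> (t + u) x"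
      by (simp add: shift)
    from no_strict_rise_and_fall[OF assms(1) cont mono this rise fall(1) cone_ll_imp_le[OF fall(2)]]
    show False .
  next
    assume "eventually_competitive C X \<phi>"
    then obtain T where "\<And>x y t. x \<in> X \<Longrightarrow> y \<in> X \<Longrightarrow> t \<le> - T \<Longrightarrow> cone_le C x y
        \<Longrightarrow> cone_le C (\<phi> t x) (\<phi> t y)"
      unfolding eventually_competitive_def by blast
    \<comment> \<open>A shift by \<open>u\<close> of the reversed orbit applies
      \<open>\<phi> (- u)\<close>, which is monotone since \<open>- u \<le> - T\<close>.\<close>
    then have mono: "\<And>s t u. u \<ge> T \<Longrightarrow> cone_le C (\<phi> (- s) x) (\<phi> (- t) x)
        \<Longrightarrow> cone_le C (\<phi> (- (s + u)) x) (\<phi> (- (t + u)) x)"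
      using orbit shift[of "- s" "- u" for s u] by simp
    have rev_shift: "\<And>s t u. \<phi> (- s) x = \<phi> (- t) x \<Longrightarrow> \<phi> (- (s + u)) x = \<phi> (- (t + u)) x"
      using shift[of "- s" "- u" for s u] by simp
    have "continuous_on UNIV (\<lambda>t. \<phi> (- t) x)"
      using continuous_on_compose2[OF cont, of UNIV uminus] by (simp add: continuous_on_minus)
    \<comment> \<open>Time reversal exchanges the roles: the fall on \<open>[c, d]\<close> becomes
      the strict rise and the rise on \<open>[a, b]\<close> the weak fall. Hence both were obtained
      as strict.\<close>
    from no_strict_rise_and_fall[OF assms(1) this mono rev_shift,
        where a = "- d" and b = "- c" and c = "- b" and d = "- a"]
    show False using rise(1) fall cone_ll_imp_le[OF rise(2)] by simp
  qed
qed

end
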